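(* Let $X$ be a classical Meixner random variable with parameters $\alpha,\alpha_0,\beta,t\in\mathbb{R}$, $t>0$, and let $a^+,a^0,a^-$ be its creation, preservation and annihilation operators. Put $\Delta=\alpha^2-4\beta$ and $\tau=2t-\alpha\alpha_0$, assume $\Delta\neq0$, and let $\delta\in\mathbb{C}$ satisfy $\delta^2=\Delta$. Then $$a^0=\frac{\alpha}{2\delta}(X-\alpha_0)\big(\mathcal{T}_\delta-\mathcal{T}_{-\delta}\big)-\frac{\alpha}{2\delta^2}(\alpha X+\tau)\big(\mathcal{T}_\delta+\mathcal{T}_{-\delta}-2I\big)+\alpha_0I,$$ $$a^-=\frac{t}{2\delta}\big(\mathcal{T}_\delta-\mathcal{T}_{-\delta}\big)+\frac{\alpha_0\delta^2+\alpha\tau}{4\delta^2}\big(\mathcal{T}_\delta+\mathcal{T}_{-\delta}-2I\big)+\frac{\beta}{\delta^2}X\big(\mathcal{T}_\delta+\mathcal{T}_{-\delta}-2I\big),$$ $$a^+=X-\frac{\alpha}{2\delta}X\big(\mathcal{T}_\delta-\mathcal{T}_{-\delta}\big)+\frac{\alpha^2+\delta^2}{4\delta^2}X\big(\mathcal{T}_\delta+\mathcal{T}_{-\delta}-2I\big)+\frac{\alpha\alpha_0-\tau}{4\delta}\big(\mathcal{T}_\delta-\mathcal{T}_{-\delta}\big)+\frac{\alpha\tau-\alpha_0\delta^2}{4\delta^2}\big(\mathcal{T}_\delta+\mathcal{T}_{-\delta}-2I\big)-\alpha_0I.$$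
   Context: Let $X$ be a real-valued random variable with finite moments of all orders on a probability space $(\Omega,\mathcal F,P)$. Let $F$ be the space of random variables $f(X)$ with $f\in\mathbb{C}[x]$, let $F_n$ be the subspace of those $f(X)$ with $\deg f\le n$, $F_{-1}=\{0\}$, and $G_n=F_n\ominus F_{n-1}$ (orthogonal complement in $L^2(\Omega,P)$). If $G_n\ne\{0\}$, let $f_n(X)$ be the unique element of $G_n$ with $f_n$ monic of degree $n$. If $G_n=\{0\}$, put $f_n(X)=0$; also $f_{-1}(X)=0$. There are real numbers $\alpha_n$, $\omega_n$ (the Szegő–Jacobi parameters of $X$) with $Xf_n(X)=f_{n+1}(X)+\alpha_nf_n(X)+\omega_nf_{n-1}(X)$ for $n\ge0$. The creation, preservation and annihilation operators $a^+,a^0,a^-:F\to F$ are the linear operators with $a^+f_n(X)=f_{n+1}(X)$, $a^0f_n(X)=\alpha_nf_n(X)$, $a^-f_n(X)=\omega_nf_{n-1}(X)$, so that multiplication by $X$ equals $a^++a^0+a^-$. $X$ is a classical Meixner random variable with parameters $\alpha,\alpha_0,\beta,t\in\mathbb{R}$ if its Szegő–Jacobi parameters are $\alpha_n=\alpha n+\alpha_0$ and $\omega_n=\beta n^2+(t-\beta)n$, where either ($\beta\ge0$ and $t\ge0$) or ($\beta<0$ and $t\in-\mathbb{N}\beta=\{-k\beta:k\in\mathbb N\}$). If $X$ takes exactly $K<\infty$ values (almost surely), the convention is $\omega_K=0$, and the formulas are required for $\alpha_n$ with $0\le n\le K-1$ and for $\omega_n$ with $1\le n\le K$; otherwise they are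 required for all $n\geq 0$ (for $\alpha_n$) and all $n\ge1$ (for $\omega_n$). Only $t>0$ is considered (for $t=0$, $X$ is constant). Operator notation: $I$ is the identity, and for $c\in\mathbb{C}$, $\mathcal{T}_c$ is the translation operator $\mathcal{T}_cf(X)=f(X+c)$. A polynomial in $X$ written to the left of an operator denotes multiplication by it (and $X$ alone denotes multiplication by $X$). An operator identity $T=\sum_j A_j(X)S_j$, where each $S_j$ is a linear combination of translations, means: for every polynomial $f\in\mathbb{C}[x]$, $T(f(X))=\sum_jA_j(X)\,(S_jf)(X)$ almost surely, where the same polynomial $f$ is used in all terms of the right-hand side. *)

theory Defs
  imports "HOL-Probability.Probability" "HOL-Computational_Algebra.Polynomial"
begin

text \<open>
  Elements of \<open>L\<^sup>2(M)\<close> are represented by functions on the sample space; equality of random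
  variables is equality almost everywhere and is written out wherever it is meant.
\<close>

definition finite_moments :: "'a measure \<Rightarrow> ('a \<Rightarrow> real) \<Rightarrow> bool" where
  "finite_moments M X \<longleftrightarrow> (\<forall>n::nat. integrable M (\<lambda>\<omega>. X \<omega> ^ n))"

definition poly_rv :: "('a \<Rightarrow> real) \<Rightarrow> complex poly \<Rightarrow> 'a \<Rightarrow> complex" where
  "poly_rv X f = (\<lambda>\<omega>. poly f (complex_of_real (X \<omega>)))"

definition ae_eq :: "'a measure \<Rightarrow> ('a \<Rightarrow> complex) \<Rightarrow> ('a \<Rightarrow> complex) \<Rightarrow> bool" where
  "ae_eq M u v \<longleftrightarrow> (AE \<omega> in M. u \<omega> = v \<omega>)"

definition L2_inner :: "'a measure \<Rightarrow> ('a \<Rightarrow> complex) \<Rightarrow> ('a \<Rightarrow> complex) \<Rightarrow> complex" where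
  "L2_inner M u v = (LINT \<omega>|M. u \<omega> * cnj (v \<omega>))"

definition F_space :: "('a \<Rightarrow> real) \<Rightarrow> ('a \<Rightarrow> complex) set" where
  "F_space X = range (poly_rv X)"

text \<open>The index is an integer so that \<open>F\<^bsub>-1\<^esub> = {0}\<close> is an instance.\<close>

definition F_sub :: "('a \<Rightarrow> real) \<Rightarrow> int \<Rightarrow> ('a \<Rightarrow> complex) set" where
  "F_sub X n = poly_rv X ` {f. f = 0 \<or> int (degree f) \<le> n}"

definition G_sub :: "'a measure \<Rightarrow> ('a \<Rightarrow> real) \<Rightarrow> int \<Rightarrow> ('a \<Rightarrow> complex) set" where
  "G_sub M X n = {u \<in> F_sub X n. \<forall>v \<in> F_sub X (n - 1). L2_inner M u v = 0}"

text \<open>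
  If \<open>G\<^sub>n \<noteq> {0}\<close>, then \<open>1, X, \<dots>, X\<^sup>n\<close> are linearly independent modulo null sets, so that
  not only the random variable \<open>f\<^sub>n(X)\<close> but also the polynomial \<open>f\<^sub>n\<close> is unique.
  For \<open>n < 0\<close> one has \<open>G\<^sub>n = {0}\<close> and hence \<open>f\<^sub>n = 0\<close>.
\<close>

definition orth_poly :: "'a measure \<Rightarrow> ('a \<Rightarrow> real) \<Rightarrow> int \<Rightarrow> complex poly" where
  "orth_poly M X n =
    (if \<exists>u \<in> G_sub M X n. \<not> ae_eq M u (\<lambda>_. 0)
     then (THE f. lead_coeff f = 1 \<and> int (degree f) = n \<and> poly_rv X f \<in> G_sub M X n)
     else 0)"

text \<open>
  The relation does not constrain \<open>a n\<close> when \<open>f\<^sub>n(X) = 0\<close>, nor \<open>w n\<close> when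
  \<open>f\<^bsub>n-1\<^esub>(X) = 0\<close> (in particular \<open>w 0\<close>).
\<close>

definition szego_jacobi ::
    "'a measure \<Rightarrow> ('a \<Rightarrow> real) \<Rightarrow> (nat \<Rightarrow> real) \<Rightarrow> (nat \<Rightarrow> real) \<Rightarrow> bool" where
  "szego_jacobi M X a w \<longleftrightarrow>
    (\<forall>n::nat. AE \<omega> in M.
       complex_of_real (X \<omega>) * poly_rv X (orth_poly M X (int n)) \<omega> =
         poly_rv X (orth_poly M X (int n + 1)) \<omega>
         + complex_of_real (a n) * poly_rv X (orth_poly M X (int n)) \<omega>
         + complex_of_real (w n) * poly_rv X (orth_poly M X (int n - 1)) \<omega>)"

definition takes_exactly :: "'a measure \<Rightarrow> ('a \<Rightarrow> real) \<Rightarrow> nat \<Rightarrow> bool" where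
  "takes_exactly M X K \<longleftrightarrow>
    (\<exists>S. finite S \<and> card S = K \<and> (AE \<omega> in M. X \<omega> \<in> S) \<and>
         (\<forall>x\<in>S. measure M {\<omega> \<in> space M. X \<omega> = x} > 0))"

definition classical_meixner ::
    "'a measure \<Rightarrow> ('a \<Rightarrow> real) \<Rightarrow> (nat \<Rightarrow> real) \<Rightarrow> (nat \<Rightarrow> real) \<Rightarrow>
     real \<Rightarrow> real \<Rightarrow> real \<Rightarrow> real \<Rightarrow> bool" where
  "classical_meixner M X a w \<alpha> \<alpha>\<^sub>0 \<beta> t \<longleftrightarrow>
    szego_jacobi M X a w \<and>
    (0 \<le> \<beta> \<and> 0 \<le> t \<or> \<beta> < 0 \<and> (\<exists>k::nat. t = - real k * \<beta>)) \<and>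
    (\<forall>K. takes_exactly M X K \<longrightarrow> w K = 0) \<and>
    (\<forall>n. (\<forall>K. takes_exactly M X K \<longrightarrow> n < K) \<longrightarrow> a n = \<alpha> * real n + \<alpha>\<^sub>0) \<and>
    (\<forall>n\<ge>1. (\<forall>K. takes_exactly M X K \<longrightarrow> n \<le> K) \<longrightarrow>
       w n = \<beta> * (real n)\<^sup>2 + (t - \<beta>) * real n)"

text \<open>Linear operators on \<open>F\<close>, as maps on representatives that respect equality almost everywhere.\<close>

definition linear_op_F ::
    "'a measure \<Rightarrow> ('a \<Rightarrow> real) \<Rightarrow> (('a \<Rightarrow> complex) \<Rightarrow> 'a \<Rightarrow> complex) \<Rightarrow> bool" where
  "linear_op_F M X T \<longleftrightarrow>
    (\<forall>u \<in> F_space X. T u \<in> F_space X) \<and>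
    (\<forall>u \<in> F_space X. \<forall>v \<in> F_space X. ae_eq M u v \<longrightarrow> ae_eq M (T u) (T v)) \<and>
    (\<forall>u \<in> F_space X. \<forall>v \<in> F_space X.
       ae_eq M (T (\<lambda>\<omega>. u \<omega> + v \<omega>)) (\<lambda>\<omega>. T u \<omega> + T v \<omega>)) \<and>
    (\<forall>c. \<forall>u \<in> F_space X. ae_eq M (T (\<lambda>\<omega>. c * u \<omega>)) (\<lambda>\<omega>. c * T u \<omega>))"

definition creation_op ::
    "'a measure \<Rightarrow> ('a \<Rightarrow> real) \<Rightarrow> (('a \<Rightarrow> complex) \<Rightarrow> 'a \<Rightarrow> complex) \<Rightarrow> bool" where
  "creation_op M X T \<longleftrightarrow> linear_op_F M X T \<and>
    (\<forall>n::nat. ae_eq M (T (poly_rv X (orth_poly M X (int n))))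
                      (poly_rv X (orth_poly M X (int n + 1))))"

definition preservation_op ::
    "'a measure \<Rightarrow> ('a \<Rightarrow> real) \<Rightarrow> (nat \<Rightarrow> real) \<Rightarrow>
     (('a \<Rightarrow> complex) \<Rightarrow> 'a \<Rightarrow> complex) \<Rightarrow> bool" where
  "preservation_op M X a T \<longleftrightarrow> linear_op_F M X T \<and>
    (\<forall>n::nat. ae_eq M (T (poly_rv X (orth_poly M X (int n))))
       (\<lambda>\<omega>. complex_of_real (a n) * poly_rv X (orth_poly M X (int n)) \<omega>))"

definition annihilation_op ::
    "'a measure \<Rightarrow> ('a \<Rightarrow> real) \<Rightarrow> (nat \<Rightarrow> real) \<Rightarrow>
     (('a \<Rightarrow> complex) \<Rightarrow> 'a \<Rightarrow> complex) \<Rightarrow> bool" where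
  "annihilation_op M X w T \<longleftrightarrow> linear_op_F M X T \<and>
    (\<forall>n::nat. ae_eq M (T (poly_rv X (orth_poly M X (int n))))
       (\<lambda>\<omega>. complex_of_real (w n) * poly_rv X (orth_poly M X (int n - 1)) \<omega>))"

text \<open>
  Translation acts on polynomials, not on random variables: \<open>f(X + c)\<close> is not determined by
  \<open>f(X)\<close> when \<open>X\<close> takes only finitely many values.
\<close>

definition translation :: "complex \<Rightarrow> complex poly \<Rightarrow> complex poly" where
  "translation c f = pcompose f [:c, 1:]"

end

(*
The Meixner polynomials P_n are defined by the three-term recurrence with the given parameters for
every n. As formal difference operators, the number operator N (with a^0 = alpha N + alpha_0) and
A = a^- satisfy the linear commutation relations
  [N, x] = x - alpha N - alpha_0 - 2 A   and   [A, x] = alpha A + 2 beta N + t,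
and these, with the recurrence, give N P_n = n P_n and A P_n = omega_n P_(n-1) by induction.
The Szego-Jacobi relation shows f_n(X) = P_n(X) almost surely. This includes the case that X takes
exactly K values, although the formulas for the parameters are then only given up to K: for n >= K
the relation multiplies the unknown parameters by f_n(X) = 0, so they may be replaced by the formal
ones. Hence the operator identities hold on every P_n(X), and by linearity everywhere.
*)
theory Submission
  imports Defs
begin

section \<open>Meixner polynomials and their difference operators\<close>

fun meixner_poly :: "complex \<Rightarrow> complex \<Rightarrow> complex \<Rightarrow> complex \<Rightarrow> nat \<Rightarrow> complex poly" where
  "meixner_poly \<alpha> \<alpha>\<^sub>0 \<beta> t 0 = 1"
| "meixner_poly \<alpha> \<alpha>\<^sub>0 \<beta> t (Suc 0) = [:- \<alpha>\<^sub>0, 1:]"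
| "meixner_poly \<alpha> \<alpha>\<^sub>0 \<beta> t (Suc (Suc n)) =
     [:- (\<alpha> * of_nat (Suc n) + \<alpha>\<^sub>0), 1:] * meixner_poly \<alpha> \<alpha>\<^sub>0 \<beta> t (Suc n)
     - smult (\<beta> * (of_nat (Suc n))\<^sup>2 + (t - \<beta>) * of_nat (Suc n)) (meixner_poly \<alpha> \<alpha>\<^sub>0 \<beta> t n)"

lemma degree_meixner_poly:
  "degree (meixner_poly \<alpha> \<alpha>\<^sub>0 \<beta> t n) = n \<and> lead_coeff (meixner_poly \<alpha> \<alpha>\<^sub>0 \<beta> t n) = 1"
proof (induction \<alpha> \<alpha>\<^sub>0 \<beta> t n rule: meixner_poly.induct)
  case (3 \<alpha> \<alpha>\<^sub>0 \<beta> t n)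
  let ?l = "[:- (\<alpha> * of_nat (Suc n) + \<alpha>\<^sub>0), 1:]" and ?p = "meixner_poly \<alpha> \<alpha>\<^sub>0 \<beta> t (Suc n)"
  let ?s = "smult (- (\<beta> * (of_nat (Suc n))\<^sup>2 + (t - \<beta>) * of_nat (Suc n))) (meixner_poly \<alpha> \<alpha>\<^sub>0 \<beta> t n)"
  have eq: "meixner_poly \<alpha> \<alpha>\<^sub>0 \<beta> t (Suc (Suc n)) = ?s + ?l * ?p"
    by (simp only: meixner_poly.simps smult_minus_left) simp
  have nz: "?p \<noteq> 0" using 3 by auto
  have deg: "degree (?l * ?p) = Suc (Suc n)"
    using nz 3 by (subst degree_mult_eq) auto
  have lc: "lead_coeff (?l * ?p) = 1"
    using 3 by (subst lead_coeff_mult) auto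
  have lt: "degree ?s < degree (?l * ?p)"
    using 3 degree_smult_le[of _ "meixner_poly \<alpha> \<alpha>\<^sub>0 \<beta> t n"] by (metis deg le_imp_less_Suc less_SucI)
  show ?case
    unfolding eq using lt deg lc by (metis degree_add_eq_right lead_coeff_add_le)
qed auto

text \<open>For a sequence of polynomials with \<open>degree (P n) = n\<close>, linearity reduces to the sequence.\<close>
lemma poly_induct_graded_basis:
  fixes P :: "nat \<Rightarrow> 'a :: field poly"
  assumes deg: "\<And>n. degree (P n) = n" and nz: "\<And>n. P n \<noteq> 0"
    and basis: "\<And>n. Q (P n)"
    and add: "\<And>f g. Q f \<Longrightarrow> Q g \<Longrightarrow> Q (f + g)"
    and smult: "\<And>c f. Q f \<Longrightarrow> Q (smult c f)"
  shows "Q f"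
proof (induction "degree f" arbitrary: f rule: less_induct)
  case less
  define n where "n = degree f"
  define c where "c = lead_coeff f / lead_coeff (P n)"
  define g where "g = f - smult c (P n)"
  have Q0: "Q 0" using smult[OF basis, of 0 0] by simp
  have cn: "coeff g n = 0"
    using nz[of n] deg[of n] leading_coeff_0_iff[of "P n"] by (simp add: g_def c_def n_def)
  have dg: "degree g \<le> n"
    unfolding g_def by (rule degree_diff_le) (auto simp: n_def deg intro: order_trans[OF degree_smult_le])
  have "Q g"
  \<comment> \<open>For \<open>n = 0\<close> the remainder is 0, and its degree is not below
    \<open>n\<close>; hence the separate case.\<close>
  proof (cases "g = 0")
    case False
    then have "degree g \<noteq> n" using cn by auto
    then show ?thesis using dg less by (simp add: n_def)
  qed (use Q0 in simp)
  then have "Q (g + smult c (P n))" by (intro add smult basis)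
  then show ?case by (simp add: g_def)
qed

text \<open>The claimed formula for the preservation operator, minus \<open>\<alpha>\<^sub>0\<close>
  times the identity and formally divided by \<alpha>, so that it makes sense for \<alpha> = 0 as
  well; \<tau> is written out.\<close>

definition number_op ::
    "complex \<Rightarrow> complex \<Rightarrow> complex \<Rightarrow> complex \<Rightarrow> complex poly \<Rightarrow> complex poly" where
  "number_op \<alpha> \<alpha>\<^sub>0 t \<delta> f =
     smult (1 / (2 * \<delta>)) ([:- \<alpha>\<^sub>0, 1:] * (translation \<delta> f - translation (- \<delta>) f))
     - smult (1 / (2 * \<delta>\<^sup>2))
         ([:2 * t - \<alpha> * \<alpha>\<^sub>0, \<alpha>:] * (translation \<delta> f + translation (- \<delta>) f - 2 * f))"

text \<open>The claimed formula for the annihilation operator, with the two second-difference terms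
  collected under one linear coefficient.\<close>

definition lowering_op ::
    "complex \<Rightarrow> complex \<Rightarrow> complex \<Rightarrow> complex \<Rightarrow> complex \<Rightarrow> complex poly \<Rightarrow> complex poly" where
  "lowering_op \<alpha> \<alpha>\<^sub>0 \<beta> t \<delta> f =
     smult (t / (2 * \<delta>)) (translation \<delta> f - translation (- \<delta>) f)
     + [:(\<alpha>\<^sub>0 * \<delta>\<^sup>2 + \<alpha> * (2 * t - \<alpha> * \<alpha>\<^sub>0)) / (4 * \<delta>\<^sup>2), \<beta> / \<delta>\<^sup>2:]
         * (translation \<delta> f + translation (- \<delta>) f - 2 * f)"

lemma poly_translation: "poly (translation c f) x = poly f (x + c)"
  by (simp add: translation_def poly_pcompose add.commute)

lemma poly_number_op:
  "poly (number_op \<alpha> \<alpha>\<^sub>0 t \<delta> f) x =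
     (x - \<alpha>\<^sub>0) / (2 * \<delta>) * (poly f (x + \<delta>) - poly f (x - \<delta>))
     - (\<alpha> * x + (2 * t - \<alpha> * \<alpha>\<^sub>0)) / (2 * \<delta>\<^sup>2) * (poly f (x + \<delta>) + poly f (x - \<delta>) - 2 * poly f x)"
  by (simp add: number_op_def poly_translation add_divide_distrib diff_divide_distrib algebra_simps)

lemma poly_lowering_op:
  "poly (lowering_op \<alpha> \<alpha>\<^sub>0 \<beta> t \<delta> f) x =
     t / (2 * \<delta>) * (poly f (x + \<delta>) - poly f (x - \<delta>))
     + ((\<alpha>\<^sub>0 * \<delta>\<^sup>2 + \<alpha> * (2 * t - \<alpha> * \<alpha>\<^sub>0)) / (4 * \<delta>\<^sup>2) + \<beta> / \<delta>\<^sup>2 * x)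
        * (poly f (x + \<delta>) + poly f (x - \<delta>) - 2 * poly f x)"
  by (simp add: lowering_op_def poly_translation algebra_simps)

lemma poly_ext:
  fixes f g :: "'a :: {idom, ring_char_0} poly"
  assumes "\<And>x. poly f x = poly g x"
  shows "f = g"
  using assms by (simp add: fun_eq_iff flip: poly_eq_poly_eq_iff)

section \<open>Linearity and commutation relations of the difference operators\<close>

lemma number_op_linear:
  "number_op \<alpha> \<alpha>\<^sub>0 t \<delta> (f + g) = number_op \<alpha> \<alpha>\<^sub>0 t \<delta> f + number_op \<alpha> \<alpha>\<^sub>0 t \<delta> g"
  "number_op \<alpha> \<alpha>\<^sub>0 t \<delta> (f - g) = number_op \<alpha> \<alpha>\<^sub>0 t \<delta> f - number_op \<alpha> \<alpha>\<^sub>0 t \<delta> g"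
  "number_op \<alpha> \<alpha>\<^sub>0 t \<delta> (smult c f) = smult c (number_op \<alpha> \<alpha>\<^sub>0 t \<delta> f)"
  by (rule poly_ext, simp add: poly_number_op add_divide_distrib diff_divide_distrib algebra_simps)+

lemma lowering_op_linear:
  "lowering_op \<alpha> \<alpha>\<^sub>0 \<beta> t \<delta> (f + g) = lowering_op \<alpha> \<alpha>\<^sub>0 \<beta> t \<delta> f + lowering_op \<alpha> \<alpha>\<^sub>0 \<beta> t \<delta> g"
  "lowering_op \<alpha> \<alpha>\<^sub>0 \<beta> t \<delta> (f - g) = lowering_op \<alpha> \<alpha>\<^sub>0 \<beta> t \<delta> f - lowering_op \<alpha> \<alpha>\<^sub>0 \<beta> t \<delta> g"
  "lowering_op \<alpha> \<alpha>\<^sub>0 \<beta> t \<delta> (smult c f) = smult c (lowering_op \<alpha> \<alpha>\<^sub>0 \<beta> t \<delta> f)"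
  by (rule poly_ext, simp add: poly_lowering_op add_divide_distrib diff_divide_distrib algebra_simps)+

text \<open>Write D for the difference and E for the second difference of step \<delta>. Since
  translation by c turns x f into (x + c) times the translate of f, [D, x] = \<delta> (E + 2 I) and
  [E, x] = \<delta> D. Comparing the coefficients of D, E and I gives the identity; the relation
  between \<delta>, \<alpha> and \<beta> enters in the coefficient of x E.\<close>

lemma number_op_commutator:
  assumes "\<delta> \<noteq> 0" "\<delta>\<^sup>2 = \<alpha>\<^sup>2 - 4 * \<beta>"
  shows "number_op \<alpha> \<alpha>\<^sub>0 t \<delta> ([:0, 1:] * f) =
    [:0, 1:] * number_op \<alpha> \<alpha>\<^sub>0 t \<delta> f + [:- \<alpha>\<^sub>0, 1:] * f - smult \<alpha> (number_op \<alpha> \<alpha>\<^sub>0 t \<delta> f)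
    - smult 2 (lowering_op \<alpha> \<alpha>\<^sub>0 \<beta> t \<delta> f)"
proof -
  \<comment> \<open>Eliminating \<beta> leaves \<alpha> and \<delta> independent, so that the claim
    becomes an identity of rational expressions.\<close>
  have b: "\<beta> = (\<alpha>\<^sup>2 - \<delta>\<^sup>2) / 4" using assms by simp
  have "poly (number_op \<alpha> \<alpha>\<^sub>0 t \<delta> ([:0, 1:] * f)) x =
    poly ([:0, 1:] * number_op \<alpha> \<alpha>\<^sub>0 t \<delta> f + [:- \<alpha>\<^sub>0, 1:] * f - smult \<alpha> (number_op \<alpha> \<alpha>\<^sub>0 t \<delta> f)
    - smult 2 (lowering_op \<alpha> \<alpha>\<^sub>0 \<beta> t \<delta> f)) x" for x
    using assms(1) unfolding b
    by (simp add: poly_number_op poly_lowering_op) (simp add: field_simps power2_eq_square)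
  then show ?thesis by (rule poly_ext)
qed

text \<open>The same exchange of D and E; the term t f comes from the 2 I in [D, x].\<close>

lemma lowering_op_commutator:
  assumes "\<delta> \<noteq> 0" "\<delta>\<^sup>2 = \<alpha>\<^sup>2 - 4 * \<beta>"
  shows "lowering_op \<alpha> \<alpha>\<^sub>0 \<beta> t \<delta> ([:0, 1:] * f) =
    [:0, 1:] * lowering_op \<alpha> \<alpha>\<^sub>0 \<beta> t \<delta> f + smult \<alpha> (lowering_op \<alpha> \<alpha>\<^sub>0 \<beta> t \<delta> f)
    + smult (2 * \<beta>) (number_op \<alpha> \<alpha>\<^sub>0 t \<delta> f) + smult t f"
proof -
  have b: "\<beta> = (\<alpha>\<^sup>2 - \<delta>\<^sup>2) / 4" using assms by simp
  have "poly (lowering_op \<alpha> \<alpha>\<^sub>0 \<beta> t \<delta> ([:0, 1:] * f)) x =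
    poly ([:0, 1:] * lowering_op \<alpha> \<alpha>\<^sub>0 \<beta> t \<delta> f + smult \<alpha> (lowering_op \<alpha> \<alpha>\<^sub>0 \<beta> t \<delta> f)
    + smult (2 * \<beta>) (number_op \<alpha> \<alpha>\<^sub>0 t \<delta> f) + smult t f) x" for x
    using assms(1) unfolding b
    by (simp add: poly_number_op poly_lowering_op) (simp add: field_simps power2_eq_square)
  then show ?thesis by (rule poly_ext)
qed

text \<open>Each commutator contains the other operator, so both relations are proved in one
  induction along the recurrence.\<close>

lemma meixner_poly_eigen:
  fixes \<alpha> \<alpha>\<^sub>0 \<beta> t \<delta> :: complex
  assumes "\<delta> \<noteq> 0" "\<delta>\<^sup>2 = \<alpha>\<^sup>2 - 4 * \<beta>"
  defines "P \<equiv> meixner_poly \<alpha> \<alpha>\<^sub>0 \<beta> t"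
  shows "number_op \<alpha> \<alpha>\<^sub>0 t \<delta> (P n) = smult (of_nat n) (P n)"
    and "lowering_op \<alpha> \<alpha>\<^sub>0 \<beta> t \<delta> (P n) =
      (case n of 0 \<Rightarrow> 0
       | Suc m \<Rightarrow> smult (\<beta> * (of_nat n)\<^sup>2 + (t - \<beta>) * of_nat n) (P m))"
proof -
  let ?N = "number_op \<alpha> \<alpha>\<^sub>0 t \<delta>" and ?A = "lowering_op \<alpha> \<alpha>\<^sub>0 \<beta> t \<delta>"
  let ?w = "\<lambda>n::nat. \<beta> * (of_nat n)\<^sup>2 + (t - \<beta>) * of_nat n"
  note comm = number_op_commutator[OF assms(1,2)] lowering_op_commutator[OF assms(1,2)]
  have lin: "[:- c, 1:] * f = [:0, 1:] * f - smult c f" for c and f :: "complex poly"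
    by (simp add: algebra_simps)
  have base: "?N 1 = 0" "?A 1 = 0"
    by (rule poly_ext, simp add: poly_number_op poly_lowering_op)+
  have linear: "[:- \<alpha>\<^sub>0, 1:] = [:0, 1:] * 1 - smult \<alpha>\<^sub>0 (1 :: complex poly)" by simp
  have base1: "?N [:- \<alpha>\<^sub>0, 1:] = [:- \<alpha>\<^sub>0, 1:]" "?A [:- \<alpha>\<^sub>0, 1:] = [:t:]"
    unfolding linear number_op_linear lowering_op_linear comm base by simp_all
  \<comment> \<open>The recurrence has two preceding terms, hence two consecutive eigenvalue claims.
    The last conjunct is the recurrence with its lower term written as \<open>?A (P n)\<close>,
    which covers \<open>n = 0\<close> and avoids a predecessor index.\<close>
  have main: "?N (P n) = smult (of_nat n) (P n) \<and> ?A (P (Suc n)) = smult (?w (Suc n)) (P n)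
      \<and> ?N (P (Suc n)) = smult (of_nat (Suc n)) (P (Suc n))
      \<and> P (Suc n) = [:0, 1:] * P n - smult (\<alpha> * of_nat n + \<alpha>\<^sub>0) (P n) - ?A (P n)" for n
  proof (induction n)
    case 0
    then show ?case by (simp add: P_def base base1)
  next
    case (Suc n)
    then have IH: "?A (P (Suc n)) = smult (?w (Suc n)) (P n)"
      "?N (P (Suc n)) = smult (of_nat (Suc n)) (P (Suc n))"
      "?N (P n) = smult (of_nat n) (P n)"
      and A_n: "?A (P n) = [:0, 1:] * P n - smult (\<alpha> * of_nat n + \<alpha>\<^sub>0) (P n) - P (Suc n)"
      by (auto simp: algebra_simps)
    define c where "c = \<alpha> * of_nat (Suc n) + \<alpha>\<^sub>0"
    have rec: "P (Suc (Suc n)) = [:0, 1:] * P (Suc n) - smult c (P (Suc n)) - smult (?w (Suc n)) (P n)"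
      by (simp only: P_def meixner_poly.simps lin c_def)
    \<comment> \<open>The term -2 A of the commutator raises the factor n of the \<open>P n\<close>
      part to n + 2; the terms in \<alpha> and \<open>\<alpha>\<^sub>0\<close> add one more
      \<open>c\<close> to the n + 1 copies already present.\<close>
    have N: "?N (P (Suc (Suc n))) = smult (of_nat (Suc (Suc n))) (P (Suc (Suc n)))"
      unfolding rec number_op_linear comm IH
      by (rule poly_ext) (simp add: c_def algebra_simps power2_eq_square)
    \<comment> \<open>After \<open>A_n\<close> the multiples of x P_n and of P_n cancel. What
      remains is P_(n+1) with factor \<omega>_(n+1) + 2 \<beta> (n+1) + t, which is
      \<omega>_(n+2).\<close>
    have A: "?A (P (Suc (Suc n))) = smult (?w (Suc (Suc n))) (P (Suc n))"
      unfolding rec lowering_op_linear comm IH A_n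
      by (rule poly_ext) (simp add: c_def algebra_simps power2_eq_square)
    have "P (Suc (Suc n)) = [:0, 1:] * P (Suc n) - smult (\<alpha> * of_nat (Suc n) + \<alpha>\<^sub>0) (P (Suc n))
        - ?A (P (Suc n))"
      unfolding IH(1) rec c_def ..
    with N A IH(2) show ?case by blast
  qed
  show "number_op \<alpha> \<alpha>\<^sub>0 t \<delta> (P n) = smult (of_nat n) (P n)" using main by blast
  show "lowering_op \<alpha> \<alpha>\<^sub>0 \<beta> t \<delta> (P n) = (case n of 0 \<Rightarrow> 0 | Suc m \<Rightarrow> smult (?w n) (P m))"
  proof (cases n)
    case (Suc m)
    have "?A (P (Suc m)) = smult (?w (Suc m)) (P m)" using main by blast
    then show ?thesis unfolding Suc nat.case .
  qed (simp add: P_def base)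
qed

section \<open>The orthogonal polynomials of a classical Meixner random variable\<close>

lemma F_sub_neg: "n < 0 \<Longrightarrow> F_sub X n = {\<lambda>_. 0}"
  by (auto simp: F_sub_def poly_rv_def image_def)

lemma orth_poly_neg:
  assumes "n < 0"
  shows "orth_poly M X n = 0"
  using F_sub_neg[OF assms, of X] by (auto simp: orth_poly_def G_sub_def ae_eq_def)

text \<open>Orthogonality to F_(-1) = {0} is vacuous, so G_0 contains all constants, and 1 is not
  null because the total mass is 1.\<close>

lemma (in prob_space) orth_poly_0: "orth_poly M X 0 = 1"
proof -
  have G: "poly_rv X [:c:] \<in> G_sub M X 0" for c
    using F_sub_neg[of "-1" X] by (auto simp: G_sub_def F_sub_def L2_inner_def)
  have "\<not> ae_eq M (poly_rv X 1) (\<lambda>_. 0)"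
    by (simp add: ae_eq_def poly_rv_def)
  with G[of 1] have ex: "\<exists>u \<in> G_sub M X 0. \<not> ae_eq M u (\<lambda>_. 0)"
    by (auto simp: one_pCons)
  have "(THE f. lead_coeff f = 1 \<and> int (degree f) = 0 \<and> poly_rv X f \<in> G_sub M X 0) = 1"
    using G[of 1] by (intro the_equality) (auto simp: one_pCons elim: degree_eq_zeroE)
  with ex show ?thesis by (simp add: orth_poly_def)
qed

text \<open>A value of positive probability lies in every set that carries \<open>X\<close> almost
  surely, so any two witnessing sets contain each other.\<close>

lemma takes_exactly_unique:
  assumes X: "X \<in> borel_measurable M" and "takes_exactly M X K" "takes_exactly M X L"
  shows "K = L"
proof -
  have sub: "S \<subseteq> S'"
    if "AE \<omega> in M. X \<omega> \<in> S'" "\<forall>x\<in>S. measure M {\<omega> \<in> space M. X \<omega> = x} > 0" for S S'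
  proof
    fix x assume "x \<in> S"
    with that(2) have pos: "measure M {\<omega> \<in> space M. X \<omega> = x} > 0" by blast
    show "x \<in> S'"
    proof (rule ccontr)
      assume "x \<notin> S'"
      with that(1) have "AE \<omega> in M. \<not> X \<omega> = x" by (auto elim: eventually_mono)
      then have "emeasure M {\<omega> \<in> space M. X \<omega> = x} = 0"
        using X by (subst (asm) AE_iff_measurable[OF _ refl]) auto
      with pos show False by (simp add: measure_def)
    qed
  qed
  from assms(2,3) show ?thesis
    unfolding takes_exactly_def using sub by (metis subset_antisym)
qed

text \<open>Modulo the polynomial \<open>q\<close> with roots at the values of \<open>X\<close>,
  every f(X) almost surely equals some g(X) with g of degree below K. An element of G_n thus has a
  version in F_(n-1), is orthogonal to itself, and is null.\<close>

lemma (in prob_space) orth_poly_vanishes: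
  assumes X: "X \<in> borel_measurable M" and K: "takes_exactly M X K" and "K \<le> n"
  shows "orth_poly M X (int n) = 0"
proof -
  from K obtain S where S: "finite S" "card S = K" "AE \<omega> in M. X \<omega> \<in> S"
    unfolding takes_exactly_def by blast
  define q where "q = (\<Prod>s\<in>S. [:- complex_of_real s, 1:])"
  have q: "q \<noteq> 0" "degree q = K"
    using S by (simp_all add: q_def degree_prod_eq_sum_degree)
  have root: "poly q (complex_of_real s) = 0" if "s \<in> S" for s
    using S that by (auto simp: q_def poly_prod)
  have [measurable]: "poly_rv X f \<in> borel_measurable M" for f
    unfolding poly_rv_def using X
    by (intro borel_measurable_continuous_on[where f = "poly f"] continuous_intros) auto
  have "ae_eq M u (\<lambda>_. 0)" if u: "u \<in> G_sub M X (int n)" for u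
  proof -
    from u obtain f where f: "u = poly_rv X f" by (auto simp: G_sub_def F_sub_def)
    have [measurable]: "u \<in> borel_measurable M" unfolding f by measurable
    have [measurable]: "(\<lambda>\<omega>. cnj (poly_rv X h \<omega>)) \<in> borel_measurable M" for h
      by (rule borel_measurable_continuous_on[where f = cnj]) (auto intro: continuous_intros)
    define g where "g = f mod q"
    have "g = 0 \<or> degree g < K" using degree_mod_less[OF q(1), of f] q by (simp add: g_def)
    then have "poly_rv X g \<in> F_sub X (int n - 1)"
      using \<open>K \<le> n\<close> by (auto simp: F_sub_def)
    then have orth: "L2_inner M u (poly_rv X g) = 0" using u by (auto simp: G_sub_def)
    have eq: "AE \<omega> in M. poly_rv X g \<omega> = u \<omega>"
      using S(3)
    proof eventually_elim
      case (elim \<omega>)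
      have "poly f (X \<omega>) = poly (f div q) (X \<omega>) * poly q (X \<omega>) + poly (f mod q) (X \<omega>)"
        by (metis div_mult_mod_eq poly_add poly_mult)
      then show ?case using root[OF elim] by (simp add: f g_def poly_rv_def)
    qed
    have "L2_inner M u (poly_rv X g) = (LINT \<omega>|M. complex_of_real ((cmod (u \<omega>))\<^sup>2))"
      unfolding L2_inner_def
    proof (rule integral_cong_AE)
      show "AE \<omega> in M. u \<omega> * cnj (poly_rv X g \<omega>) = complex_of_real ((cmod (u \<omega>))\<^sup>2)"
        using eq by eventually_elim (simp only: complex_norm_square)
    qed measurable
    with orth have int0: "(LINT \<omega>|M. (cmod (u \<omega>))\<^sup>2) = 0"
      by (metis integral_complex_of_real of_real_eq_0_iff)
    \<comment> \<open>A Bochner integral defaults to 0 for non-integrable functions, so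
      integrability must be shown before \<open>int0\<close> can be used; \<open>u\<close> is almost
      surely bounded by its values on \<open>S\<close>.\<close>
    define B where "B = Max ((\<lambda>s. (cmod (poly f (complex_of_real s)))\<^sup>2) ` S)"
    have "integrable M (\<lambda>\<omega>. (cmod (u \<omega>))\<^sup>2)"
    proof (rule integrable_const_bound[where B = B])
      show "AE \<omega> in M. norm ((cmod (u \<omega>))\<^sup>2) \<le> B"
        using S(3) by eventually_elim (auto simp: B_def f poly_rv_def S(1) intro!: Max_ge)
    qed measurable
    then have "AE \<omega> in M. (cmod (u \<omega>))\<^sup>2 = 0"
      using int0 by (subst (asm) integral_nonneg_eq_0_iff_AE) auto
    then show ?thesis by (simp add: ae_eq_def)
  qed
  then show ?thesis by (auto simp: orth_poly_def)
qed

text \<open>Both sequences obey the same recurrence outside one null set. The parameter equations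
  are multiplied by P_n(X) because beyond the number of values the parameters are not prescribed,
  while this factor vanishes almost surely.\<close>

lemma classical_meixner_orth_poly:
  fixes \<alpha> \<alpha>\<^sub>0 \<beta> t :: real
  assumes "prob_space M" and X: "X \<in> borel_measurable M"
    and meixner: "classical_meixner M X a w \<alpha> \<alpha>\<^sub>0 \<beta> t"
  defines "P \<equiv> meixner_poly \<alpha> \<alpha>\<^sub>0 \<beta> t"
  shows "AE \<omega> in M. \<forall>n.
    poly_rv X (orth_poly M X (int n)) \<omega> = poly_rv X (P n) \<omega>
    \<and> a n * poly_rv X (P n) \<omega> = complex_of_real (\<alpha> * real n + \<alpha>\<^sub>0) * poly_rv X (P n) \<omega>
    \<and> w (Suc n) * poly_rv X (P n) \<omega>
        = complex_of_real (\<beta> * (real (Suc n))\<^sup>2 + (t - \<beta>) * real (Suc n)) * poly_rv X (P n) \<omega>"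
proof -
  interpret prob_space M by fact
  let ?o = "\<lambda>n \<omega>. poly_rv X (orth_poly M X (int n)) \<omega>"
  let ?w = "\<lambda>n::nat. complex_of_real (\<beta> * (real n)\<^sup>2 + (t - \<beta>) * real n)"
  have an: "orth_poly M X (int n) = 0 \<or> a n = \<alpha> * real n + \<alpha>\<^sub>0" for n
    using meixner orth_poly_vanishes[OF X, of _ n] unfolding classical_meixner_def by (meson not_less)
  \<comment> \<open>The formula for \<open>w (Suc n)\<close> is prescribed when
    \<open>Suc n \<le> K\<close>; otherwise \<open>K \<le> n\<close>, which already makes f_n
    vanish.\<close>
  have wn: "orth_poly M X (int n) = 0 \<or> w (Suc n) = \<beta> * (real (Suc n))\<^sup>2 + (t - \<beta>) * real (Suc n)" for n
  proof (cases "\<exists>K\<le>n. takes_exactly M X K")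
    case False
    then show ?thesis using meixner unfolding classical_meixner_def
      by (metis One_nat_def Suc_le_mono le0 not_less_eq_eq)
  qed (use orth_poly_vanishes[OF X] in blast)
  have "AE \<omega> in M. \<forall>n. complex_of_real (X \<omega>) * ?o n \<omega> =
      poly_rv X (orth_poly M X (int n + 1)) \<omega> + complex_of_real (a n) * ?o n \<omega>
         + complex_of_real (w n) * poly_rv X (orth_poly M X (int n - 1)) \<omega>"
    using meixner by (simp add: classical_meixner_def szego_jacobi_def AE_all_countable)
  then show ?thesis
  proof eventually_elim
    case (elim \<omega>)
    let ?x = "complex_of_real (X \<omega>)"
    have A: "a n * ?o n \<omega> = complex_of_real (\<alpha> * real n + \<alpha>\<^sub>0) * ?o n \<omega>" for n
      using an[of n] by (auto simp: poly_rv_def)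
    have W: "w (Suc n) * ?o n \<omega> = ?w (Suc n) * ?o n \<omega>" for n
      using wn[of n] by (auto simp: poly_rv_def)
    have o: "?o n \<omega> = poly (P n) ?x \<and> ?o (Suc n) \<omega> = poly (P (Suc n)) ?x" for n
    proof (induction n)
      case 0
      \<comment> \<open>The unconstrained \<open>w 0\<close> drops out, since it multiplies f_(-1) =
        0.\<close>
      have "?o (Suc 0) \<omega> = ?x - \<alpha>\<^sub>0"
        using elim[rule_format, of 0] A[of 0] by (simp add: orth_poly_0 orth_poly_neg poly_rv_def algebra_simps)
      then show ?case by (simp add: orth_poly_0 P_def poly_rv_def)
    next
      case (Suc n)
      have i: "int (Suc n) + 1 = int (Suc (Suc n))" "int (Suc n) - 1 = int n" by auto
      have "?o (Suc (Suc n)) \<omega> = ?x * ?o (Suc n) \<omega> - complex_of_real (\<alpha> * real (Suc n) + \<alpha>\<^sub>0) * ?o (Suc n) \<omega>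
          - ?w (Suc n) * ?o n \<omega>"
        using elim[rule_format, of "Suc n"] A[of "Suc n"] W[of n] unfolding i
        by (simp only: algebra_simps)
      also have "\<dots> = poly (P (Suc (Suc n))) ?x"
        using Suc by (simp add: P_def) (simp add: algebra_simps)
      finally show ?case using Suc by simp
    qed
    show ?case using A W o by (simp add: poly_rv_def)
  qed
qed

section \<open>From polynomials to operators on random variables\<close>

text \<open>The polynomials on which \<open>T\<close> and \<open>L\<close> agree almost surely are
  closed under linear combinations, and the P_n span. \<open>L\<close> acts on polynomials because
  translations are not defined on random variables.\<close>

lemma linear_op_F_eqI:
  assumes T: "linear_op_F M X T"
    and basis: "\<And>n. ae_eq M (T (poly_rv X (P n))) (poly_rv X (L (P n)))"
    and P: "\<And>n. degree (P n) = n" "\<And>n. P n \<noteq> 0"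
    and L: "\<And>f g. L (f + g) = L f + L g" "\<And>c f. L (smult c f) = smult c (L f)"
  shows "ae_eq M (T (poly_rv X f)) (poly_rv X (L f))"
proof (rule poly_induct_graded_basis[where P = P and
      Q = "\<lambda>f. ae_eq M (T (poly_rv X f)) (poly_rv X (L f))"])
  fix f g assume f: "ae_eq M (T (poly_rv X f)) (poly_rv X (L f))"
    and g: "ae_eq M (T (poly_rv X g)) (poly_rv X (L g))"
  have "poly_rv X (f + g) = (\<lambda>\<omega>. poly_rv X f \<omega> + poly_rv X g \<omega>)" by (simp add: poly_rv_def)
  then have "ae_eq M (T (poly_rv X (f + g))) (\<lambda>\<omega>. T (poly_rv X f) \<omega> + T (poly_rv X g) \<omega>)"
    using T by (simp add: linear_op_F_def F_space_def)
  with f g show "ae_eq M (T (poly_rv X (f + g))) (poly_rv X (L (f + g)))"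
    unfolding ae_eq_def by eventually_elim (simp add: L poly_rv_def)
next
  fix c f assume f: "ae_eq M (T (poly_rv X f)) (poly_rv X (L f))"
  have "poly_rv X (smult c f) = (\<lambda>\<omega>. c * poly_rv X f \<omega>)" by (simp add: poly_rv_def)
  then have "ae_eq M (T (poly_rv X (smult c f))) (\<lambda>\<omega>. c * T (poly_rv X f) \<omega>)"
    using T by (simp add: linear_op_F_def F_space_def)
  with f show "ae_eq M (T (poly_rv X (smult c f))) (poly_rv X (L (smult c f)))"
    unfolding ae_eq_def by eventually_elim (simp add: L poly_rv_def)
qed (use assms in auto)

theorem mainTheorem3:
  fixes M :: "'a measure" and X :: "'a \<Rightarrow> real"
    and a w :: "nat \<Rightarrow> real"
    and \<alpha> \<alpha>\<^sub>0 \<beta> t \<Delta> \<tau> :: real and \<delta> :: complex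
    and cre pre ann :: "('a \<Rightarrow> complex) \<Rightarrow> 'a \<Rightarrow> complex"
  assumes "prob_space M"
    and "X \<in> borel_measurable M"
    and "finite_moments M X"
    and "classical_meixner M X a w \<alpha> \<alpha>\<^sub>0 \<beta> t"
    and "t > 0"
    and "creation_op M X cre"
    and "preservation_op M X a pre"
    and "annihilation_op M X w ann"
    and "\<Delta> = \<alpha>\<^sup>2 - 4 * \<beta>"
    and "\<tau> = 2 * t - \<alpha> * \<alpha>\<^sub>0"
    and "\<Delta> \<noteq> 0"
    and "\<delta>\<^sup>2 = complex_of_real \<Delta>"
  shows
    "(\<forall>f :: complex poly. AE \<omega> in M.
        pre (poly_rv X f) \<omega> =
          \<alpha> / (2 * \<delta>) * (X \<omega> - \<alpha>\<^sub>0) * poly_rv X (translation \<delta> f - translation (- \<delta>) f) \<omega>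
          - \<alpha> / (2 * \<delta>\<^sup>2) * (\<alpha> * X \<omega> + \<tau>)
              * poly_rv X (translation \<delta> f + translation (- \<delta>) f - 2 * f) \<omega>
          + \<alpha>\<^sub>0 * poly_rv X f \<omega>) \<and>
     (\<forall>f :: complex poly. AE \<omega> in M.
        ann (poly_rv X f) \<omega> =
          t / (2 * \<delta>) * poly_rv X (translation \<delta> f - translation (- \<delta>) f) \<omega>
          + (\<alpha>\<^sub>0 * \<delta>\<^sup>2 + \<alpha> * \<tau>) / (4 * \<delta>\<^sup>2)
              * poly_rv X (translation \<delta> f + translation (- \<delta>) f - 2 * f) \<omega>
          + \<beta> / \<delta>\<^sup>2 * X \<omega>
              * poly_rv X (translation \<delta> f + translation (- \<delta>) f - 2 * f) \<omega>) \<and>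
     (\<forall>f :: complex poly. AE \<omega> in M.
        cre (poly_rv X f) \<omega> =
          X \<omega> * poly_rv X f \<omega>
          - \<alpha> / (2 * \<delta>) * X \<omega> * poly_rv X (translation \<delta> f - translation (- \<delta>) f) \<omega>
          + (\<alpha>\<^sup>2 + \<delta>\<^sup>2) / (4 * \<delta>\<^sup>2) * X \<omega>
              * poly_rv X (translation \<delta> f + translation (- \<delta>) f - 2 * f) \<omega>
          + (\<alpha> * \<alpha>\<^sub>0 - \<tau>) / (4 * \<delta>)
              * poly_rv X (translation \<delta> f - translation (- \<delta>) f) \<omega>
          + (\<alpha> * \<tau> - \<alpha>\<^sub>0 * \<delta>\<^sup>2) / (4 * \<delta>\<^sup>2)
              * poly_rv X (translation \<delta> f + translation (- \<delta>) f - 2 * f) \<omega>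
          - \<alpha>\<^sub>0 * poly_rv X f \<omega>)"
proof -
  interpret prob_space M by fact
  have d: "\<delta> \<noteq> 0" using assms(11,12) by auto
  have d2: "\<delta>\<^sup>2 = (complex_of_real \<alpha>)\<^sup>2 - 4 * complex_of_real \<beta>" using assms(9,12) by simp
  then have b: "complex_of_real \<beta> = ((complex_of_real \<alpha>)\<^sup>2 - \<delta>\<^sup>2) / 4" by simp
  define P where "P = meixner_poly \<alpha> \<alpha>\<^sub>0 \<beta> t"
  let ?N = "number_op \<alpha> \<alpha>\<^sub>0 t \<delta>" and ?A = "lowering_op \<alpha> \<alpha>\<^sub>0 \<beta> t \<delta>"
  let ?P = "\<lambda>n. poly_rv X (P n)" and ?o = "\<lambda>n. poly_rv X (orth_poly M X (int n))"
  let ?w = "\<lambda>n::nat. complex_of_real (\<beta> * (real n)\<^sup>2 + (t - \<beta>) * real n)"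
  note eigen = meixner_poly_eigen[OF d d2, where \<alpha>\<^sub>0 = "of_real \<alpha>\<^sub>0" and t = "of_real t", folded P_def]
  have P: "degree (P n) = n" "P n \<noteq> 0" for n
    using degree_meixner_poly[of \<alpha> \<alpha>\<^sub>0 \<beta> t n] by (auto simp: P_def)
  have orth: "AE \<omega> in M. \<forall>n. ?o n \<omega> = ?P n \<omega>
      \<and> a n * ?P n \<omega> = complex_of_real (\<alpha> * real n + \<alpha>\<^sub>0) * ?P n \<omega> \<and> w (Suc n) * ?P n \<omega> = ?w (Suc n) * ?P n \<omega>"
    unfolding P_def by (rule classical_meixner_orth_poly) fact+
  \<comment> \<open>The operators are specified on f_n(X); as they respect almost sure equality,
    their values on P_n(X) follow.\<close>
  have transfer: "ae_eq M (T (?P n)) u" if "linear_op_F M X T" "ae_eq M (T (?o n)) u" for T u n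
  proof -
    have "ae_eq M (?P n) (?o n)" unfolding ae_eq_def using orth by eventually_elim simp
    then have "ae_eq M (T (?P n)) (T (?o n))"
      using that(1) by (simp add: linear_op_F_def F_space_def)
    with that(2) show ?thesis unfolding ae_eq_def by eventually_elim simp
  qed
  \<comment> \<open>For \<open>n = 0\<close> both sides vanish; for a successor the factor
    P_(n-1)(X) allows the actual parameter to be replaced by the formal one.\<close>
  have ann_P: "w n * poly_rv X (orth_poly M X (int n - 1)) \<omega> = poly_rv X (?A (P n)) \<omega>"
    if "\<forall>n. ?o n \<omega> = ?P n \<omega>
      \<and> a n * ?P n \<omega> = complex_of_real (\<alpha> * real n + \<alpha>\<^sub>0) * ?P n \<omega> \<and> w (Suc n) * ?P n \<omega> = ?w (Suc n) * ?P n \<omega>" for n \<omega>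
  proof (cases n)
    case 0
    then show ?thesis using eigen(2)[of 0] by (simp add: orth_poly_neg poly_rv_def)
  next
    case (Suc m)
    then have "w n * poly_rv X (orth_poly M X (int n - 1)) \<omega> = ?w n * ?P m \<omega>"
      using that by simp
    then show ?thesis using Suc by (simp add: eigen poly_rv_def)
  qed

  have pre: "ae_eq M (pre (poly_rv X f)) (poly_rv X (smult \<alpha> (?N f) + smult \<alpha>\<^sub>0 f))" for f
  proof (rule linear_op_F_eqI[where P = P and L = "\<lambda>f. smult \<alpha> (?N f) + smult \<alpha>\<^sub>0 f"])
    show lin: "linear_op_F M X pre" using assms(7) by (simp add: preservation_op_def)
    show "ae_eq M (pre (?P n)) (poly_rv X (smult \<alpha> (?N (P n)) + smult \<alpha>\<^sub>0 (P n)))" for n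
    proof (rule transfer[OF lin])
      have "ae_eq M (pre (?o n)) (\<lambda>\<omega>. a n * ?o n \<omega>)"
        using assms(7) by (simp add: preservation_op_def)
      then show "ae_eq M (pre (?o n)) (poly_rv X (smult \<alpha> (?N (P n)) + smult \<alpha>\<^sub>0 (P n)))"
        using orth unfolding ae_eq_def by eventually_elim (simp add: eigen poly_rv_def algebra_simps)
    qed
  qed (simp_all add: P number_op_linear smult_add_right mult.commute)
  have ann: "ae_eq M (ann (poly_rv X f)) (poly_rv X (?A f))" for f
  proof (rule linear_op_F_eqI[where P = P and L = ?A])
    show lin: "linear_op_F M X ann" using assms(8) by (simp add: annihilation_op_def)
    show "ae_eq M (ann (?P n)) (poly_rv X (?A (P n)))" for n
    proof (rule transfer[OF lin])
      have "ae_eq M (ann (?o n)) (\<lambda>\<omega>. w n * poly_rv X (orth_poly M X (int n - 1)) \<omega>)"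
        using assms(8) by (simp add: annihilation_op_def)
      then show "ae_eq M (ann (?o n)) (poly_rv X (?A (P n)))"
        using orth unfolding ae_eq_def by eventually_elim (simp add: ann_P)
    qed
  qed (simp_all add: P lowering_op_linear)
  \<comment> \<open>This is multiplication by x minus the formal preservation and annihilation
    operators.\<close>
  let ?C = "\<lambda>f. [:- \<alpha>\<^sub>0, 1:] * f - smult \<alpha> (?N f) - ?A f"
  have cre: "ae_eq M (cre (poly_rv X f)) (poly_rv X (?C f))" for f
  proof (rule linear_op_F_eqI[where P = P and L = ?C])
    show lin: "linear_op_F M X cre" using assms(6) by (simp add: creation_op_def)
    show "ae_eq M (cre (?P n)) (poly_rv X (?C (P n)))" for n
    proof (rule transfer[OF lin])
      \<comment> \<open>By the eigenrelations this is the three-term recurrence; the case split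
        matches its separate initial values.\<close>
      have step: "P (Suc n) = ?C (P n)"
        unfolding eigen unfolding P_def
        by (rule poly_ext, cases n) (simp_all, simp add: algebra_simps)
      have "ae_eq M (cre (?o n)) (?o (Suc n))"
        using assms(6) by (simp add: creation_op_def add.commute)
      then show "ae_eq M (cre (?o n)) (poly_rv X (?C (P n)))"
        using orth unfolding step[symmetric] ae_eq_def by eventually_elim metis
    qed
  qed (simp_all add: P number_op_linear lowering_op_linear smult_add_right smult_diff_right algebra_simps)

  have tau: "complex_of_real \<tau> = 2 * t - \<alpha> * \<alpha>\<^sub>0" by (simp add: assms(10))
  show ?thesis
  proof (intro conjI allI, goal_cases)
    case (1 f)
    show ?case using pre[of f] unfolding ae_eq_def
      by eventually_elim
        (use d in \<open>simp add: poly_translation tau poly_rv_def poly_number_op, simp add: field_simps power2_eq_square\<close>)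
  next
    case (2 f)
    show ?case using ann[of f] unfolding ae_eq_def
      by eventually_elim
        (use d in \<open>simp add: poly_translation tau poly_rv_def poly_lowering_op, simp add: field_simps power2_eq_square\<close>)
  next
    \<comment> \<open>The coefficient of X E is \<alpha>^2 / (2 \<delta>^2) - \<beta> / \<delta>^2,
      which takes the stated form once \<open>b\<close> eliminates \<beta>.\<close>
    case (3 f)
    show ?case using cre[of f] unfolding ae_eq_def
      by eventually_elim
        (use d in \<open>simp add: poly_translation tau b poly_rv_def poly_number_op poly_lowering_op,
          simp add: field_simps power2_eq_square\<close>)
  qed
qed

end
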